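(* Let $a=(a_1,\dots,a_n)$ and $b=(b_1,\dots,b_m)$ be probability vectors with positive entries and let $C=(c_{ij})\in\mathbb{R}_{\ge 0}^{n\times m}$. Fix $\varepsilon>0$. For $\lambda>0$ let $\Gamma^{\varepsilon,\lambda}$ be the unique minimizer of the entropic partial optimal transport problem with data $(a,b,C)$ and parameters $\varepsilon,\lambda$, and define $$Z_\lambda=\sum_{i=1}^{n}\sum_{j=1}^{m}\Gamma^{\varepsilon,\lambda}_{ij}.$$ Then $Z_\lambda\to 1$ as $\lambda\to\infty$. More precisely, if $M=\max_{1\le i\le n,\,1\le j\le m}c_{ij}$ and $2\lambda>M$, then $$0\le 1-Z_\lambda\le\frac{\varepsilon(n+1)(m+1)}{2\lambda-M}.$$
   Context: For nonnegative vectors $r,s$ of equal total mass, $\Pi(r,s)$ is the set of nonnegative matrices with row sums $r$ and column sums $s$. The extended marginals are $\widetilde a=(a_1,\dots,a_n,1)$ and $\widetilde b=(b_1,\dots,b_m,1)$. The extended cost matrix has entries $\widetilde c^{\lambda}_{ij}=c_{ij}-2\lambda$ if $1\le i\le n$ and $1\le j\le m$, and $\widetilde c^{\lambda}_{ij}=0$ otherwise (for $1\le i\le n+1$, $1\le j\le m+1$). For a nonnegative matrix $A$, $E(A)=\sum_{i,j}A_{ij}(\log A_{ij}-1)$, with $0\log 0=0$. The entropic partial optimal transport problem is $$\mathrm{OT}_{\varepsilon,\lambda}(a,b)=\min_{\Gamma\in\Pi(\widetilde a,\widetilde b)}\left\{\sum_{i=1}^{n+1}\sum_{j=1}^{m+1}\widetilde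 c^{\lambda}_{ij}\Gamma_{ij}+\varepsilon E(\Gamma)+2\lambda\right\};$$ it has a unique minimizer. *)

theory Defs
  imports "HOL-Analysis.Analysis"
begin

text \<open>
  The index sets \<open>{1..n}\<close> and \<open>{1..m}\<close> are finite types \<open>'n\<close> and \<open>'m\<close>.  The extended index set
  \<open>{1..n+1}\<close> is the type \<open>'n option\<close>: \<open>Some i\<close> is an original index, \<open>None\<close> is the index \<open>n+1\<close>.
  A matrix with rows indexed by \<open>'i\<close> and columns indexed by \<open>'j\<close> has type \<open>real^'j^'i\<close>.
\<close>

definition transport_polytope ::
  "real^'i::finite \<Rightarrow> real^'j::finite \<Rightarrow> (real^'j^'i) set" where
  "transport_polytope r s =
     {\<Gamma>. (\<forall>i j. 0 \<le> \<Gamma> $ i $ j) \<and>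
         (\<forall>i. (\<Sum>j\<in>UNIV. \<Gamma> $ i $ j) = r $ i) \<and>
         (\<forall>j. (\<Sum>i\<in>UNIV. \<Gamma> $ i $ j) = s $ j)}"

definition ext_marginal :: "real^'n::finite \<Rightarrow> real^('n option)" where
  "ext_marginal a = (\<chi> i. case i of Some k \<Rightarrow> a $ k | None \<Rightarrow> 1)"

definition ext_cost ::
  "real \<Rightarrow> real^'m::finite^'n::finite \<Rightarrow> real^('m option)^('n option)" where
  "ext_cost lam C =
     (\<chi> i j. case (i, j) of (Some k, Some l) \<Rightarrow> C $ k $ l - 2 * lam | _ \<Rightarrow> 0)"

text \<open>The convention \<open>0 log 0 = 0\<close> holds because \<open>0 * x = 0\<close> for every real \<open>x\<close>.\<close>

definition entropy :: "real^'j::finite^'i::finite \<Rightarrow> real" where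
  "entropy A = (\<Sum>i\<in>UNIV. \<Sum>j\<in>UNIV. A $ i $ j * (ln (A $ i $ j) - 1))"

definition epot_objective ::
  "real^'m::finite^'n::finite \<Rightarrow> real \<Rightarrow> real \<Rightarrow> real^('m option)^('n option) \<Rightarrow> real" where
  "epot_objective C \<epsilon> lam \<Gamma> =
     (\<Sum>i\<in>UNIV. \<Sum>j\<in>UNIV. ext_cost lam C $ i $ j * \<Gamma> $ i $ j) + \<epsilon> * entropy \<Gamma> + 2 * lam"

definition is_epot_minimizer ::
  "real^'n::finite \<Rightarrow> real^'m::finite \<Rightarrow> real^'m^'n \<Rightarrow> real \<Rightarrow> real \<Rightarrow>
     real^('m option)^('n option) \<Rightarrow> bool" where
  "is_epot_minimizer a b C \<epsilon> lam =
     is_arg_min (epot_objective C \<epsilon> lam)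
       (\<lambda>\<Gamma>. \<Gamma> \<in> transport_polytope (ext_marginal a) (ext_marginal b))"

definition epot_plan ::
  "real^'n::finite \<Rightarrow> real^'m::finite \<Rightarrow> real^'m^'n \<Rightarrow> real \<Rightarrow> real \<Rightarrow>
     real^('m option)^('n option)" where
  "epot_plan a b C \<epsilon> lam = (THE \<Gamma>. is_epot_minimizer a b C \<epsilon> lam \<Gamma>)"

definition transported_mass ::
  "real^'n::finite \<Rightarrow> real^'m::finite \<Rightarrow> real^'m^'n \<Rightarrow> real \<Rightarrow> real \<Rightarrow> real" where
  "transported_mass a b C \<epsilon> lam =
     (\<Sum>i\<in>UNIV. \<Sum>j\<in>UNIV. epot_plan a b C \<epsilon> lam $ Some i $ Some j)"

end

theory Submission
  imports Defs "HOL-Real_Asymp.Real_Asymp"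
begin

text \<open>
  Moving the untransported mass \<open>D = 1 - Z\<close> into the inner block (as the product of the two
  residual marginals, divided by \<open>D\<close>) yields a competitor whose linear cost is smaller by at least
  \<open>(2\<lambda> - M) D\<close>.  Every entry of a feasible plan lies in \<open>[0,1]\<close>, where \<open>-1 \<le> x (ln x - 1) \<le> 0\<close>,
  so the entropy grows by at most \<open>(n+1)(m+1)\<close>.  Optimality of the original plan therefore bounds
  \<open>D\<close>.  Existence and uniqueness of the plan come from compactness and strict convexity.
\<close>

lemma sum_UNIV_option:
  fixes f :: "'a::finite option \<Rightarrow> 'b::comm_monoid_add"
  shows "sum f UNIV = (\<Sum>i\<in>UNIV. f (Some i)) + f None"
  by (simp add: UNIV_option_conv sum.reindex add.commute)

section \<open>Convexity and continuity of the scalar function x (ln x - 1)\<close>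

text \<open>The derivative of x (ln x - 1) is ln x, so this is the graph lying above its tangent at
  \<open>m\<close>. Only the base point must be positive: \<open>x = 0\<close> is allowed, which
  later covers zero entries of a plan.\<close>

lemma xlnx_above_tangent:
  fixes x m :: real
  assumes "0 \<le> x" "0 < m"
  shows "m * (ln m - 1) + ln m * (x - m) \<le> x * (ln x - 1)"
    and "x \<noteq> m \<Longrightarrow> m * (ln m - 1) + ln m * (x - m) < x * (ln x - 1)"
proof -
  have gap: "x * (ln x - 1) - (m * (ln m - 1) + ln m * (x - m)) = x * (ln x - ln m) - x + m"
    by (simp add: algebra_simps)
  show strict: "m * (ln m - 1) + ln m * (x - m) < x * (ln x - 1)" if "x \<noteq> m"
  proof (cases "x = 0")
    case True
    then show ?thesis using gap assms by simp
  next
    case False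
    with assms have x: "0 < x" by simp
    \<comment> \<open>Strict, since equality in ln t \<le> t - 1 holds only at t = 1. Multiplying by
      \<open>x\<close> turns this into positivity of \<open>gap\<close>.\<close>
    have "ln (m / x) < m / x - 1"
      using ln_le_minus_one[of "m / x"] ln_eq_minus_one[of "m / x"] x assms that
      by (force simp: less_le)
    then have "x * (ln m - ln x) < x * (m / x - 1)"
      using x assms by (simp add: ln_div)
    also have "\<dots> = m - x" using x by (simp add: field_simps)
    finally show ?thesis using gap by (simp add: algebra_simps)
  qed
  show "m * (ln m - 1) + ln m * (x - m) \<le> x * (ln x - 1)"
    using strict by (cases "x = m") auto
qed

text \<open>Add the tangent inequalities at the midpoint for \<open>x\<close> and \<open>y\<close>:
  the linear terms cancel. If \<open>x \<noteq> y\<close>, the midpoint is positive, so the tangent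
  exists.\<close>

lemma xlnx_midpoint:
  fixes x y :: real
  assumes "0 \<le> x" "0 \<le> y"
  shows "(x + y) / 2 * (ln ((x + y) / 2) - 1) \<le> (x * (ln x - 1) + y * (ln y - 1)) / 2"
    and "x \<noteq> y \<Longrightarrow>
      (x + y) / 2 * (ln ((x + y) / 2) - 1) < (x * (ln x - 1) + y * (ln y - 1)) / 2"
proof -
  define m where "m = (x + y) / 2"
  show strict: "(x + y) / 2 * (ln ((x + y) / 2) - 1) < (x * (ln x - 1) + y * (ln y - 1)) / 2"
    if "x \<noteq> y"
  proof -
    have m: "0 < m" "x \<noteq> m" "y \<noteq> m" using assms that by (auto simp: m_def)
    have "ln m * (x - m) + ln m * (y - m) = 0"
      by (simp add: m_def field_simps)
    moreover have "p < (q + r) / 2" if "p + u < q" "p + v < r" "u + v = 0" for p q r u v :: real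
      using that by argo
    ultimately show ?thesis
      using xlnx_above_tangent(2)[OF assms(1) m(1,2)] xlnx_above_tangent(2)[OF assms(2) m(1,3)]
      unfolding m_def[symmetric] by blast
  qed
  show "(x + y) / 2 * (ln ((x + y) / 2) - 1) \<le> (x * (ln x - 1) + y * (ln y - 1)) / 2"
    using strict by (cases "x = y") auto
qed

lemma continuous_on_xlnx: "continuous_on {0..} (\<lambda>x::real. x * (ln x - 1))"
proof -
  have "continuous (at x within {0..}) (\<lambda>x::real. x * (ln x - 1))" if "0 \<le> x" for x
  proof (cases "x = 0")
    case True
    \<comment> \<open>The function takes the value 0 at 0 because of the factor \<open>x\<close>, so
      this one-sided limit is exactly continuity there.\<close>
    have "((\<lambda>x::real. x * (ln x - 1)) \<longlongrightarrow> 0) (at_right 0)" by real_asymp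
    then show ?thesis
      using True by (simp add: continuous_within at_within_Ici_at_right)
  next
    case False
    then show ?thesis using that by (auto intro!: continuous_intros)
  qed
  then show ?thesis by (simp add: continuous_on_eq_continuous_within)
qed

section \<open>Compactness, nonemptiness and midpoints of the transport polytope\<close>

lemma compact_transport_polytope: "compact (transport_polytope r s)"
proof -
  have "closed (transport_polytope r s)"
    unfolding transport_polytope_def
    by (intro closed_Collect_conj closed_Collect_all closed_Collect_le closed_Collect_eq
        continuous_intros)
  moreover have "bounded (transport_polytope r s)"
  proof (rule boundedI)
    fix A assume A: "A \<in> transport_polytope r s"
    \<comment> \<open>The norm is at most the sum of absolute values of the entries, which for a
      feasible plan is its fixed total mass.\<close>
    have "norm A \<le> (\<Sum>i\<in>UNIV. norm (A $ i))"
      unfolding norm_vec_def by (rule L2_set_le_sum) auto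
    also have "\<dots> \<le> (\<Sum>i\<in>UNIV. \<Sum>j\<in>UNIV. \<bar>A $ i $ j\<bar>)"
      by (intro sum_mono norm_le_l1_cart)
    also have "\<dots> = (\<Sum>i\<in>UNIV. r $ i)"
      using A by (simp add: transport_polytope_def)
    finally show "norm A \<le> (\<Sum>i\<in>UNIV. r $ i)" .
  qed
  ultimately show ?thesis by (simp add: compact_eq_bounded_closed)
qed

lemma transport_polytope_nonempty:
  assumes "\<And>i. 0 \<le> r $ i" "\<And>j. 0 \<le> s $ j"
    and "(\<Sum>i\<in>UNIV. r $ i) = t" "(\<Sum>j\<in>UNIV. s $ j) = t" "0 < t"
  shows "transport_polytope r s \<noteq> {}"
proof -
  \<comment> \<open>The product coupling; dividing by the common mass \<open>t\<close> restores the
    marginals.\<close>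
  have "(\<chi> i j. r $ i * s $ j / t) \<in> transport_polytope r s"
    using assms
    by (auto simp: transport_polytope_def simp flip: sum_divide_distrib sum_distrib_left
        sum_distrib_right)
  then show ?thesis by blast
qed

lemma transport_polytope_midpoint:
  assumes "A \<in> transport_polytope r s" "B \<in> transport_polytope r s"
  shows "(1/2) *\<^sub>R (A + B) \<in> transport_polytope r s"
  using assms
  by (simp add: transport_polytope_def sum.distrib flip: sum_divide_distrib)

section \<open>Continuity, strict convexity and range of the entropy\<close>

lemma continuous_on_entropy: "continuous_on (transport_polytope r s) entropy"
  unfolding entropy_def
  by (intro continuous_on_sum continuous_on_compose2[OF continuous_on_xlnx] continuous_intros)
    (auto simp: transport_polytope_def)

lemma entropy_midpoint_less:
  assumes nn: "\<And>i j. 0 \<le> A $ i $ j" "\<And>i j. 0 \<le> B $ i $ j" and "A \<noteq> B"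
  shows "entropy ((1/2) *\<^sub>R (A + B)) < (entropy A + entropy B) / 2"
proof -
  obtain k l where kl: "A $ k $ l \<noteq> B $ k $ l"
    using \<open>A \<noteq> B\<close> by (auto simp: vec_eq_iff)
  let ?h = "\<lambda>x::real. x * (ln x - 1)"
  let ?m = "\<lambda>i j. ?h ((A $ i $ j + B $ i $ j) / 2)"
  let ?a = "\<lambda>i j. (?h (A $ i $ j) + ?h (B $ i $ j)) / 2"
  have le: "?m i j \<le> ?a i j" for i j
    using xlnx_midpoint(1)[OF nn(1)[of i j] nn(2)[of i j]] .
  \<comment> \<open>One differing entry makes its row sum strict, and one strict row makes the
    double sum strict.\<close>
  have "(\<Sum>j\<in>UNIV. ?m k j) < (\<Sum>j\<in>UNIV. ?a k j)"
    using le xlnx_midpoint(2)[OF nn(1)[of k l] nn(2)[of k l] kl]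
    by (intro sum_strict_mono_ex1) auto
  then have "(\<Sum>i\<in>UNIV. \<Sum>j\<in>UNIV. ?m i j) < (\<Sum>i\<in>UNIV. \<Sum>j\<in>UNIV. ?a i j)"
    using le by (intro sum_strict_mono_ex1) (auto intro: sum_mono)
  then show ?thesis
    unfolding entropy_def by (simp add: sum.distrib flip: sum_divide_distrib)
qed

lemma entropy_bounds:
  fixes A :: "real^'j::finite^'i::finite"
  assumes "\<And>i j. 0 \<le> A $ i $ j" "\<And>i j. A $ i $ j \<le> 1"
  shows "- (real CARD('i) * real CARD('j)) \<le> entropy A" "entropy A \<le> 0"
proof -
  have "(\<Sum>i\<in>(UNIV::'i set). \<Sum>j\<in>(UNIV::'j set). - 1) \<le> entropy A"
    unfolding entropy_def
  proof (intro sum_mono)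
    \<comment> \<open>The tangent at 1 has slope \<open>ln 1 = 0\<close> and height -1.\<close>
    fix i j show "- 1 \<le> A $ i $ j * (ln (A $ i $ j) - 1)"
      using xlnx_above_tangent(1)[OF assms(1)[of i j], of 1] by simp
  qed
  then show "- (real CARD('i) * real CARD('j)) \<le> entropy A" by simp
  show "entropy A \<le> 0"
    unfolding entropy_def
  proof (intro sum_nonpos mult_nonneg_nonpos assms)
    fix i j
    \<comment> \<open>The factor is bounded separately at a zero entry, where the default
      \<open>ln 0 = 0\<close> gives -1.\<close>
    show "ln (A $ i $ j) - 1 \<le> 0"
      using assms[of i j] ln_le_minus_one[of "A $ i $ j"]
      by (cases "A $ i $ j = 0") auto
  qed
qed

section \<open>Existence and uniqueness of the optimal plan\<close>

text \<open>Since \<open>epot_plan\<close> is a definite description, both existence and uniqueness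
  are required to know that it is a minimizer.\<close>

lemma ex1_epot_minimizer:
  fixes a :: "real^'n::finite" and b :: "real^'m::finite"
  assumes "\<forall>i. 0 \<le> a $ i" "(\<Sum>i\<in>UNIV. a $ i) = 1"
    and "\<forall>j. 0 \<le> b $ j" "(\<Sum>j\<in>UNIV. b $ j) = 1" and "0 < \<epsilon>"
  shows "\<exists>!\<Gamma>. is_epot_minimizer a b C \<epsilon> lam \<Gamma>"
proof (rule ex_ex1I)
  let ?P = "transport_polytope (ext_marginal a) (ext_marginal b)"
  let ?F = "epot_objective C \<epsilon> lam"
  have "?P \<noteq> {}"
    using assms
    \<comment> \<open>Each extended marginal has mass 2: the original mass 1 plus the slack entry
      1.\<close>
    by (intro transport_polytope_nonempty[where t = 2])
      (auto simp: ext_marginal_def sum_UNIV_option split: option.split)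
  moreover have "continuous_on ?P ?F"
    unfolding epot_objective_def by (intro continuous_intros continuous_on_entropy)
  ultimately obtain \<Gamma> where "\<Gamma> \<in> ?P" "\<forall>\<Delta>\<in>?P. ?F \<Gamma> \<le> ?F \<Delta>"
    using continuous_attains_inf[OF compact_transport_polytope] by blast
  then show "\<exists>\<Gamma>. is_epot_minimizer a b C \<epsilon> lam \<Gamma>"
    by (auto simp: is_epot_minimizer_def is_arg_min_linorder)
next
  fix A B
  assume "is_epot_minimizer a b C \<epsilon> lam A" "is_epot_minimizer a b C \<epsilon> lam B"
  then have A: "A \<in> transport_polytope (ext_marginal a) (ext_marginal b)"
    and B: "B \<in> transport_polytope (ext_marginal a) (ext_marginal b)"
    and min: "\<And>D. D \<in> transport_polytope (ext_marginal a) (ext_marginal b) \<Longrightarrow>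
      epot_objective C \<epsilon> lam A \<le> epot_objective C \<epsilon> lam D \<and>
      epot_objective C \<epsilon> lam B \<le> epot_objective C \<epsilon> lam D"
    by (auto simp: is_epot_minimizer_def is_arg_min_linorder)
  show "A = B"
  proof (rule ccontr)
    assume "A \<noteq> B"
    let ?D = "(1/2) *\<^sub>R (A + B)"
    let ?L = "\<lambda>X. \<Sum>i\<in>UNIV. \<Sum>j\<in>UNIV. ext_cost lam C $ i $ j * X $ i $ j"
    have "\<epsilon> * entropy ?D < \<epsilon> * ((entropy A + entropy B) / 2)"
      using A B \<open>A \<noteq> B\<close> \<open>0 < \<epsilon>\<close>
      by (intro mult_strict_left_mono entropy_midpoint_less) (auto simp: transport_polytope_def)
    \<comment> \<open>The linear part averages exactly, so the strict entropy gain makes the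
      midpoint beat two supposed minimizers.\<close>
    moreover have "?L ?D = (?L A + ?L B) / 2"
      by (simp add: distrib_left sum.distrib flip: sum_divide_distrib)
    ultimately have "2 * epot_objective C \<epsilon> lam ?D
        < epot_objective C \<epsilon> lam A + epot_objective C \<epsilon> lam B"
      unfolding epot_objective_def by (simp add: algebra_simps)
    with min[OF transport_polytope_midpoint[OF A B]] show False by linarith
  qed
qed

section \<open>Quantitative bound on the untransported mass\<close>

lemma ext_polytope_entry_le_1:
  assumes "A \<in> transport_polytope (ext_marginal a) s" "\<And>i. a $ i \<le> 1"
  shows "A $ i $ j \<le> 1"
proof -
  have "A $ i $ j \<le> (\<Sum>j\<in>UNIV. A $ i $ j)"
    using assms(1) by (intro member_le_sum) (auto simp: transport_polytope_def)
  also have "\<dots> \<le> 1"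
    using assms by (auto simp: transport_polytope_def ext_marginal_def split: option.split)
  finally show ?thesis .
qed

lemma linear_cost_ext:
  "(\<Sum>i\<in>UNIV. \<Sum>j\<in>UNIV. ext_cost lam C $ i $ j * A $ i $ j) =
   (\<Sum>i\<in>UNIV. \<Sum>j\<in>UNIV. (C $ i $ j - 2 * lam) * A $ Some i $ Some j)"
  by (simp add: sum_UNIV_option ext_cost_def)

lemma epot_minimizer_mass_bounds:
  fixes a :: "real^'n::finite" and b :: "real^'m::finite"
  assumes a: "\<forall>i. 0 \<le> a $ i" "(\<Sum>i\<in>UNIV. a $ i) = 1"
    and b: "(\<Sum>j\<in>UNIV. b $ j) = 1"
    and M: "\<And>i j. C $ i $ j \<le> M" and "0 \<le> \<epsilon>" and lam: "M < 2 * lam"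
    and min: "is_epot_minimizer a b C \<epsilon> lam \<Gamma>"
  defines "D \<equiv> 1 - (\<Sum>i\<in>UNIV. \<Sum>j\<in>UNIV. \<Gamma> $ Some i $ Some j)"
  shows "0 \<le> D" "D \<le> \<epsilon> * (real CARD('n) + 1) * (real CARD('m) + 1) / (2 * lam - M)"
proof -
  let ?P = "transport_polytope (ext_marginal a) (ext_marginal b)"
  have \<Gamma>: "\<Gamma> \<in> ?P" and opt: "\<And>\<Delta>. \<Delta> \<in> ?P \<Longrightarrow> epot_objective C \<epsilon> lam \<Gamma> \<le> epot_objective C \<epsilon> lam \<Delta>"
    using min by (auto simp: is_epot_minimizer_def is_arg_min_linorder)
  \<comment> \<open>The slack column \<open>r\<close> and slack row \<open>s\<close> are the
    residual marginals of the inner block; both have total mass \<open>D\<close>.\<close>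
  define r where "r i = \<Gamma> $ Some i $ None" for i
  define s where "s j = \<Gamma> $ None $ Some j" for j
  have nn: "0 \<le> \<Gamma> $ i $ j" for i j
    using \<Gamma> by (simp add: transport_polytope_def)
  have row: "(\<Sum>j\<in>UNIV. \<Gamma> $ Some i $ Some j) + r i = a $ i" for i
    using \<Gamma> unfolding transport_polytope_def r_def
    by (auto simp: sum_UNIV_option ext_marginal_def dest: spec[of _ "Some i"])
  have col: "(\<Sum>i\<in>UNIV. \<Gamma> $ Some i $ Some j) + s j = b $ j" for j
    using \<Gamma> unfolding transport_polytope_def s_def
    by (auto simp: sum_UNIV_option ext_marginal_def dest: spec[of _ "Some j"])
  have sum_r: "(\<Sum>i\<in>UNIV. r i) = D"
    using a(2) unfolding row[symmetric] D_def by (simp add: sum.distrib)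
  have sum_s: "(\<Sum>j\<in>UNIV. s j) = D"
    using b unfolding col[symmetric] D_def
    by (subst sum.swap) (simp add: sum.distrib)
  show D0: "0 \<le> D"
    unfolding sum_r[symmetric] by (simp add: r_def nn sum_nonneg)
  have pos: "0 \<le> \<epsilon> * (real CARD('n) + 1) * (real CARD('m) + 1) / (2 * lam - M)"
    using \<open>0 \<le> \<epsilon>\<close> lam by simp
  show "D \<le> \<epsilon> * (real CARD('n) + 1) * (real CARD('m) + 1) / (2 * lam - M)"
  proof (cases "D = 0")
    case True
    then show ?thesis using pos by simp
  next
    case False
    with D0 have D: "0 < D" by simp
    \<comment> \<open>The product coupling of \<open>r\<close> and \<open>s\<close>, of mass
      \<open>D\<close>; the normalisation is why \<open>D = 0\<close> was split off.\<close>
    define q where "q i j = r i * s j / D" for i j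
    have q0: "0 \<le> q i j" for i j
      using D by (simp add: q_def r_def s_def nn)
    have q_row: "(\<Sum>j\<in>UNIV. q i j) = r i" for i
      using D sum_s by (simp add: q_def flip: sum_divide_distrib sum_distrib_left)
    have q_col: "(\<Sum>i\<in>UNIV. q i j) = s j" for j
      using D sum_r by (simp add: q_def flip: sum_divide_distrib sum_distrib_right)
    \<comment> \<open>Adding \<open>q\<close> fills the inner marginals completely, so the slack
      entries vanish and the corner must be 1.\<close>
    define \<Delta> :: "real^('m option)^('n option)" where
      "\<Delta> = (\<chi> i j. case (i, j) of (Some k, Some l) \<Rightarrow> \<Gamma> $ Some k $ Some l + q k l
                 | (None, None) \<Rightarrow> 1 | _ \<Rightarrow> 0)"
    have \<Delta>: "\<Delta> \<in> ?P"
      unfolding transport_polytope_def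
    proof (intro CollectI conjI allI)
      show "0 \<le> \<Delta> $ i $ j" for i j
        by (auto simp: \<Delta>_def nn q0 split: option.split)
      show "(\<Sum>j\<in>UNIV. \<Delta> $ i $ j) = ext_marginal a $ i" for i
        by (cases i) (simp_all add: \<Delta>_def sum_UNIV_option ext_marginal_def sum.distrib q_row row)
      show "(\<Sum>i\<in>UNIV. \<Delta> $ i $ j) = ext_marginal b $ j" for j
        by (cases j) (simp_all add: \<Delta>_def sum_UNIV_option ext_marginal_def sum.distrib q_col col)
    qed
    have "a $ i \<le> 1" for i
      using member_le_sum[of i UNIV "\<lambda>i. a $ i"] a by simp
    then have le1: "A $ i $ j \<le> 1" if "A \<in> ?P" for A i j
      using ext_polytope_entry_le_1 that by blast
    have "entropy \<Delta> \<le> 0"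
      using \<Delta> le1[OF \<Delta>] by (intro entropy_bounds) (simp_all add: transport_polytope_def)
    moreover have "- ((real CARD('n) + 1) * (real CARD('m) + 1)) \<le> entropy \<Gamma>"
      using entropy_bounds(1)[OF nn le1[OF \<Gamma>]] by (simp add: card_UNIV_option add.commute)
    ultimately have ent:
      "\<epsilon> * (entropy \<Delta> - entropy \<Gamma>) \<le> \<epsilon> * ((real CARD('n) + 1) * (real CARD('m) + 1))"
      using \<open>0 \<le> \<epsilon>\<close> by (intro mult_left_mono) auto
    \<comment> \<open>\<open>\<Delta>\<close> and \<open>\<Gamma>\<close> differ in linear cost only
      by the cost of \<open>q\<close>, at most \<open>M - 2 * lam\<close> per unit of mass.\<close>
    have "(\<Sum>i\<in>UNIV. \<Sum>j\<in>UNIV. (C $ i $ j - 2 * lam) * q i j)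
        \<le> (\<Sum>i\<in>UNIV. \<Sum>j\<in>UNIV. (M - 2 * lam) * q i j)"
      using M q0 by (intro sum_mono mult_right_mono) auto
    also have "\<dots> = (M - 2 * lam) * D"
      by (simp add: q_row sum_r flip: sum_distrib_left)
    finally have "(2 * lam - M) * D \<le> \<epsilon> * (entropy \<Delta> - entropy \<Gamma>)"
      using opt[OF \<Delta>] unfolding epot_objective_def linear_cost_ext
      by (simp add: \<Delta>_def distrib_left sum.distrib) (simp add: algebra_simps)
    with ent show ?thesis
      using lam by (simp add: field_simps)
  qed
qed

theorem proposition3p3:
  fixes a :: "real^'n::finite" and b :: "real^'m::finite"
    and C :: "real^'m^'n" and \<epsilon> M :: real
  assumes "\<forall>i. 0 < a $ i" and "(\<Sum>i\<in>UNIV. a $ i) = 1"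
    and "\<forall>j. 0 < b $ j" and "(\<Sum>j\<in>UNIV. b $ j) = 1"
    and "\<forall>i j. 0 \<le> C $ i $ j"
    and "0 < \<epsilon>"
    and "M = Max {C $ i $ j | i j. True}"
  shows "((\<lambda>lam. transported_mass a b C \<epsilon> lam) \<longlongrightarrow> 1) at_top \<and>
    (\<forall>lam>0. 2 * lam > M \<longrightarrow>
       0 \<le> 1 - transported_mass a b C \<epsilon> lam \<and>
       1 - transported_mass a b C \<epsilon> lam
         \<le> \<epsilon> * (real CARD('n) + 1) * (real CARD('m) + 1) / (2 * lam - M))"
proof -
  let ?Z = "transported_mass a b C \<epsilon>"
  let ?K = "\<epsilon> * (real CARD('n) + 1) * (real CARD('m) + 1)"
  have nonneg: "\<forall>i. 0 \<le> a $ i" "\<forall>j. 0 \<le> b $ j"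
    using assms(1,3) by (auto simp: less_imp_le)
  \<comment> \<open>As an image of a finite type the set is finite, so its \<open>Max\<close> bounds
    every entry.\<close>
  have "{C $ i $ j | i j. True} = (\<lambda>(i, j). C $ i $ j) ` UNIV"
    by auto
  then have CM: "C $ i $ j \<le> M" for i j
    unfolding assms(7) by (intro Max_ge) auto
  have bound: "0 \<le> 1 - ?Z lam \<and> 1 - ?Z lam \<le> ?K / (2 * lam - M)" if "M < 2 * lam" for lam
  proof -
    have "is_epot_minimizer a b C \<epsilon> lam (epot_plan a b C \<epsilon> lam)"
      unfolding epot_plan_def
      by (rule theI', rule ex1_epot_minimizer[OF nonneg(1) assms(2) nonneg(2) assms(4,6)])
    from epot_minimizer_mass_bounds[OF nonneg(1) assms(2,4) CM less_imp_le[OF assms(6)] that this]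
    show ?thesis unfolding transported_mass_def by simp
  qed
  \<comment> \<open>The bound holds for all large \<open>lam\<close>, squeezing the mass between
    \<open>1 - ?K / (2 * lam - M)\<close> and 1.\<close>
  have "eventually (\<lambda>lam. M < 2 * lam) at_top"
    using eventually_gt_at_top[of "M / 2"] by eventually_elim simp
  then have "eventually (\<lambda>lam. 0 \<le> 1 - ?Z lam \<and> 1 - ?Z lam \<le> ?K / (2 * lam - M)) at_top"
    by (rule eventually_mono) (rule bound)
  then have lower: "eventually (\<lambda>lam. 1 - ?K / (2 * lam - M) \<le> ?Z lam) at_top"
    and upper: "eventually (\<lambda>lam. ?Z lam \<le> 1) at_top"
    by (rule eventually_mono, linarith)+
  have "((\<lambda>lam. 1 - ?K / (2 * lam - M)) \<longlongrightarrow> 1 - 0) at_top"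
  proof (intro tendsto_intros tendsto_divide_0[OF tendsto_const] filterlim_at_top_imp_at_infinity)
    show "filterlim (\<lambda>lam. 2 * lam - M) at_top at_top" by real_asymp
  qed
  then have "((\<lambda>lam. 1 - ?K / (2 * lam - M)) \<longlongrightarrow> 1) at_top"
    by simp
  from tendsto_sandwich[OF lower upper this tendsto_const]
  have "(?Z \<longlongrightarrow> 1) at_top" .
  with bound show ?thesis by blast
qed

end
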